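(* Let $(X,d)$ be a metric space, $x_0\in X$, $Y$ a topological vector space quasi-ordered by a convex cone $K$, $H\subset K$ a nonempty $\sigma$-convex set such that $0\notin\mathrm{vcl}(K+H)$, and let $f:X\to 2^Y$ be a set-valued map. For any $x\in X$, put $$S(x):=\{x'\in X:\ f(x)\subset f(x')+d(x,x')H+K\}.$$ Suppose that the following conditions are satisfied: (i) $(X,d)$ is $S(x_0)$-dynamically complete; (ii) there exists $\epsilon>0$ such that $f(x_0)\not\subset f(S(x_0))+\epsilon H+K$; (iii) $f$ is $K$-slm and has $K$-closed values, i.e., for any $x\in X$, $f(x)+K$ is closed. Then there exists $\bar x\in X$ such that (a) $f(x_0)\subset f(\bar x)+d(x_0,\bar x)H+K$; (b) for all $x\in X\setminus\{\bar x\}$, $f(\bar x)\not\subset f(x)+d(\bar x,x)H+K$.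
   Context: Topological vector spaces are real and Hausdorff. $2^Y$ is the family of all subsets of $Y$; for $A\subset X$, $f(A)=\bigcup_{x\in A}f(x)$. For $A,B\subset Y$ and $\alpha\in\mathbb R$, $A+B=\{a+b:a\in A,b\in B\}$ and $\alpha A=\{\alpha a:a\in A\}$. A cone is a nonempty set $K\subset Y$ with $\alpha K\subset K$ for all $\alpha\ge 0$; it is a convex cone if also $K+K\subset K$. Cones are always assumed nontrivial: $K\ne\{0\}$ and $K\ne Y$. The quasi-order given by $K$ is $y_1\le_K y_2\iff y_1-y_2\in -K$. For nonempty $A\subset Y$, the vector closure is $\mathrm{vcl}(A)=\{y\in Y:\exists v\in Y,\ \exists \lambda_n\ge 0,\ \lambda_n\to 0 \text{ with } y+\lambda_n v\in A\ \forall n\in\mathbb N\}$. A set $B\subset Y$ is $\sigma$-convex if every convex series of points of $B$, i.e. every series $\sum_{n=1}^\infty\lambda_n b_n$ with $b_n\in B$, $\lambda_n\ge 0$, $\sum_{n=1}^\infty\lambda_n=1$, converges to a point of $B$. $f$ is $K$-slm ($K$-sequentially lower monotone) if for any sequence $(x_n)\subset X$ with $x_n\to\bar x\in X$ and $f(x_n)\subset f(x_{n+1})+K$ for all $n$, one has $f(x_n)\subset f(\bar x)+K$ for all $n$. $(X,d)$ is $S(x)$-dynamically complete if for any Cauchy sequence $(x_n)\subset S(x)$ with $x_{n+1}\in S(x_n)$ for all $n$, there exists $\bar x\in X$ with $x_n\to\bar x$. *)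

theory Defs
  imports "HOL-Analysis.Analysis"
begin

text \<open>
  Sums of sets are those of \<^theory>\<open>HOL-Library.Set_Algebras\<close>; the dilation of a set \<open>A\<close> by a
  real \<open>r\<close> is written \<open>scaleR r ` A\<close>.
\<close>

text \<open>Real Hausdorff topological vector spaces, with joint continuity of the scalar multiplication
  phrased as joint continuity of addition is in \<^class>\<open>topological_monoid_add\<close>.\<close>

class real_hausdorff_tvs = real_vector + topological_ab_group_add + t2_space +
  assumes tendsto_scaleR_Pair:
    "LIM z (nhds r \<times>\<^sub>F nhds a). fst z *\<^sub>R snd z :> nhds (r *\<^sub>R a)"

instance real_normed_vector \<subseteq> real_hausdorff_tvs
proof
  fix r :: real and a :: 'a
  show "LIM z (nhds r \<times>\<^sub>F nhds a). fst z *\<^sub>R snd z :> nhds (r *\<^sub>R a)"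
    by (intro tendsto_scaleR filterlim_fst filterlim_snd)
qed

definition vcl :: "'b::real_vector set \<Rightarrow> 'b set" where
  "vcl A = {y. \<exists>v. \<exists>l :: nat \<Rightarrow> real.
      (\<forall>n. 0 \<le> l n) \<and> l \<longlonglongrightarrow> 0 \<and> (\<forall>n. y + l n *\<^sub>R v \<in> A)}"

definition sigma_convex :: "'b::real_hausdorff_tvs set \<Rightarrow> bool" where
  "sigma_convex B \<longleftrightarrow> (\<forall>b :: nat \<Rightarrow> 'b. \<forall>l :: nat \<Rightarrow> real.
      (\<forall>n. b n \<in> B) \<longrightarrow> (\<forall>n. 0 \<le> l n) \<longrightarrow> l sums 1 \<longrightarrow>
      (\<exists>y\<in>B. (\<lambda>n. l n *\<^sub>R b n) sums y))"

definition K_slm :: "'b::plus set \<Rightarrow> ('a::topological_space \<Rightarrow> 'b set) \<Rightarrow> bool" where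
  "K_slm K f \<longleftrightarrow> (\<forall>(x :: nat \<Rightarrow> 'a) xbar.
      x \<longlonglongrightarrow> xbar \<longrightarrow> (\<forall>n. f (x n) \<subseteq> f (x (Suc n)) + K) \<longrightarrow>
      (\<forall>n. f (x n) \<subseteq> f xbar + K))"

text \<open>In the following the whole space is complete with respect to \<open>S\<close>-chains inside \<open>S x\<close>;
  the limit is not required to lie in \<open>S x\<close>.\<close>

definition dynamically_complete :: "('a::metric_space \<Rightarrow> 'a set) \<Rightarrow> 'a \<Rightarrow> bool" where
  "dynamically_complete S x \<longleftrightarrow> (\<forall>u :: nat \<Rightarrow> 'a.
      Cauchy u \<longrightarrow> (\<forall>n. u n \<in> S x) \<longrightarrow> (\<forall>n. u (Suc n) \<in> S (u n)) \<longrightarrow>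
      (\<exists>xbar. u \<longlonglongrightarrow> xbar))"

definition S_map ::
    "('a::metric_space \<Rightarrow> 'b::real_vector set) \<Rightarrow> 'b set \<Rightarrow> 'b set \<Rightarrow> 'a \<Rightarrow> 'a set" where
  "S_map f H K x = {x'. f x \<subseteq> f x' + scaleR (dist x x') ` H + K}"

end

theory Submission
  imports Defs
begin

text \<open>
  Read \<open>x' \<in> S x\<close> as "moving from \<open>x\<close> to \<open>x'\<close> lowers the value of \<open>f\<close> by at least the distance
  travelled, measured along \<open>H\<close>". The set \<open>H\<close> is convex, so successive decreases add up
  (\<open>subset_dilation_trans\<close>): along a chain \<open>u (Suc n) \<in> S (u n)\<close> the value drops by at least the
  total length of the chain times \<open>H\<close>. By hypothesis some value in \<open>f x0\<close> cannot
  be lowered by \<open>\<epsilon> H\<close> to a value of \<open>f\<close> on \<open>S x0\<close>, so the initial segments of a chain issuing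
  from \<open>x0\<close> have length less than \<open>\<epsilon>\<close> (\<open>chain_length_less\<close>); the chain is therefore Cauchy and, by
  dynamical completeness, convergent.

  The chain is built greedily: each step is at least half as long as any other one available.
  Two facts identify its limit \<open>z\<close> as the required point. First, \<open>z\<close> lies in \<open>S (u n)\<close>
  for all \<open>n\<close> (\<open>limit_mem_S_map\<close>): the infinitely many decreases along the tail of the chain form a
  series which, up to normalisation, is a convex series of points of \<open>H\<close>; by \<open>\<sigma>\<close>-convexity it sums
  to (length of the tail) times a single point of \<open>H\<close>, and since
  sequential lower monotonicity puts every partially lowered value into \<open>f z + K\<close>, closedness of
  \<open>f z + K\<close> lets the decrease pass to the limit. Secondly, any \<open>x \<in> S z\<close> then belongs to all the \<open>S (u n)\<close> by
  transitivity, and the greedy choice bounds \<open>dist (u n) x\<close> by twice the length of the \<open>n\<close>-th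
  step, which tends to \<open>0\<close>; hence \<open>u\<close> converges to \<open>x\<close> as well, and \<open>x = z\<close>.
\<close>

section \<open>Chains of finite length in metric spaces\<close>

lemma dist_le_sum_dist:
  fixes u :: "nat \<Rightarrow> 'a::metric_space"
  assumes "m \<le> n"
  shows "dist (u m) (u n) \<le> (\<Sum>i=m..<n. dist (u i) (u (Suc i)))"
  using assms
proof (induction n rule: dec_induct)
  case (step n)
  have "dist (u m) (u (Suc n)) \<le> dist (u m) (u n) + dist (u n) (u (Suc n))"
    by (rule dist_triangle)
  with step show ?case by simp
qed simp

lemma Cauchy_if_summable_dist:
  fixes u :: "nat \<Rightarrow> 'a::metric_space"
  assumes "summable (\<lambda>n. dist (u n) (u (Suc n)))"
  shows "Cauchy u"
proof (rule metric_CauchyI)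
  fix e :: real assume "e > 0"
  then obtain N where N: "\<And>m n. m \<ge> N \<Longrightarrow> \<bar>\<Sum>i=m..<n. dist (u i) (u (Suc i))\<bar> < e"
    using assms unfolding summable_Cauchy real_norm_def by meson
  have "dist (u m) (u n) < e" if "N \<le> m" "m \<le> n" for m n
    using dist_le_sum_dist[OF \<open>m \<le> n\<close>, of u] N[OF \<open>N \<le> m\<close>, of n] by linarith
  then show "\<exists>M. \<forall>m\<ge>M. \<forall>n\<ge>M. dist (u m) (u n) < e"
    by (metis dist_commute nat_le_linear)
qed

lemma dist_limit_le_suminf_dist:
  fixes u :: "nat \<Rightarrow> 'a::metric_space"
  assumes summable: "summable (\<lambda>n. dist (u n) (u (Suc n)))" and lim: "u \<longlonglongrightarrow> z"
  shows "dist (u 0) z \<le> (\<Sum>n. dist (u n) (u (Suc n)))"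
proof (rule LIMSEQ_le_const2)
  show "(\<lambda>n. dist (u 0) (u n)) \<longlonglongrightarrow> dist (u 0) z"
    by (intro tendsto_intros lim)
  have "dist (u 0) (u n) \<le> (\<Sum>n. dist (u n) (u (Suc n)))" for n
    using dist_le_sum_dist[of 0 n u] sum_le_suminf[OF summable, of "{..<n}"]
    by (simp add: lessThan_atLeast0)
  then show "\<exists>N. \<forall>n\<ge>N. dist (u 0) (u n) \<le> (\<Sum>n. dist (u n) (u (Suc n)))"
    by blast
qed

text \<open>
  A farthest point of a bounded set need not exist, but some point lies strictly beyond half of
  the supremum of the distances, unless that supremum is \<open>0\<close>; then \<open>T = {x}\<close>, and \<open>x\<close> itself serves.
\<close>

lemma near_farthest_point:
  fixes x :: "'a::metric_space"
  assumes "x \<in> T" and bound: "\<And>z. z \<in> T \<Longrightarrow> dist x z \<le> C"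
  shows "\<exists>x'\<in>T. \<forall>z\<in>T. dist x z \<le> 2 * dist x x'"
proof -
  define M where "M = (SUP z\<in>T. dist x z)"
  have bdd: "bdd_above (dist x ` T)"
    using bound by (rule bdd_aboveI2)
  have upper: "dist x z \<le> M" if "z \<in> T" for z
    unfolding M_def using that bdd by (rule cSUP_upper)
  show ?thesis
  proof (cases "M > 0")
    case True
    then have "M / 2 < (SUP z\<in>T. dist x z)"
      by (simp add: M_def)
    then obtain x' where x': "x' \<in> T" "M / 2 < dist x x'"
      using less_cSUP_iff[OF _ bdd] \<open>x \<in> T\<close> by blast
    have "\<forall>z\<in>T. dist x z \<le> 2 * dist x x'"
      using upper x'(2) by fastforce
    with x'(1) show ?thesis ..
  next
    case False
    then have "dist x z \<le> 2 * dist x x" if "z \<in> T" for z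
      using upper[OF that] zero_le_dist[of x x] by linarith
    with \<open>x \<in> T\<close> show ?thesis by blast
  qed
qed

section \<open>Convex series\<close>

lemma tendsto_scaleR_const:
  fixes g :: "'i \<Rightarrow> 'b::real_hausdorff_tvs"
  assumes "(g \<longlongrightarrow> a) F"
  shows "((\<lambda>i. r *\<^sub>R g i) \<longlongrightarrow> r *\<^sub>R a) F"
proof -
  have "filterlim (\<lambda>i. (r, g i)) (nhds r \<times>\<^sub>F nhds a) F"
    by (intro filterlim_Pair tendsto_const assms)
  from filterlim_compose[OF tendsto_scaleR_Pair this] show ?thesis
    by simp
qed

text \<open>
  A finite convex combination is a convex series with almost all weights zero, and in a Hausdorff
  space its sum is unambiguous.
\<close>

lemma sigma_convex_imp_convex:
  fixes B :: "'b::real_hausdorff_tvs set"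
  assumes "sigma_convex B"
  shows "convex B"
proof (rule convexI)
  fix x y :: 'b and s t :: real
  assume xy: "x \<in> B" "y \<in> B" and st: "0 \<le> s" "0 \<le> t" "s + t = 1"
  define b where "b n = (if n = 0 then x else y)" for n :: nat
  define l where "l n = (if n = 0 then s else if n = 1 then t else 0)" for n :: nat
  have "l sums (\<Sum>n\<in>{0, 1}. l n)"
    by (rule sums_finite) (auto simp: l_def)
  then have "l sums 1"
    using st(3) by (simp add: l_def)
  moreover have "\<forall>n. b n \<in> B" "\<forall>n. 0 \<le> l n"
    using xy st by (auto simp: b_def l_def)
  ultimately obtain w where w: "w \<in> B" "(\<lambda>n. l n *\<^sub>R b n) sums w"
    using assms unfolding sigma_convex_def by meson
  have "(\<lambda>n. l n *\<^sub>R b n) sums (\<Sum>n\<in>{0, 1}. l n *\<^sub>R b n)"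
    by (rule sums_finite) (auto simp: l_def)
  then have "(\<lambda>n. l n *\<^sub>R b n) sums (s *\<^sub>R x + t *\<^sub>R y)"
    by (simp add: l_def b_def)
  then show "s *\<^sub>R x + t *\<^sub>R y \<in> B"
    using w sums_unique2 by blast
qed

text \<open>
  The homogeneous form of \<open>\<sigma>\<close>-convexity: the weights may have any total mass \<open>D\<close>. If \<open>D = 0\<close>, all
  weights vanish and every point of \<open>B\<close> is a witness.
\<close>

lemma sigma_convex_weighted_sums:
  fixes B :: "'b::real_hausdorff_tvs set"
  assumes "sigma_convex B" and b: "\<And>n. b n \<in> B"
    and nonneg: "\<And>n. 0 \<le> d n" and sums: "d sums D"
  shows "\<exists>h\<in>B. (\<lambda>n. d n *\<^sub>R b n) sums (D *\<^sub>R h)"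
proof (cases "D = 0")
  case True
  then have "d n = 0" for n
    using suminf_eq_zero_iff[of d] nonneg sums by (simp add: sums_iff)
  then have "(\<lambda>n. d n *\<^sub>R b n) sums (D *\<^sub>R b 0)"
    using True by simp
  with b show ?thesis by blast
next
  case False
  then have "D > 0"
    using sums suminf_nonneg[of d] nonneg by (auto simp: sums_iff less_le)
  then have "(\<lambda>n. d n / D) sums 1" "\<forall>n. 0 \<le> d n / D"
    using sums_divide[OF sums, of D] nonneg by auto
  then obtain h where h: "h \<in> B" "(\<lambda>n. (d n / D) *\<^sub>R b n) sums h"
    using \<open>sigma_convex B\<close> b unfolding sigma_convex_def by meson
  have "(\<lambda>m. D *\<^sub>R (\<Sum>n<m. (d n / D) *\<^sub>R b n)) \<longlonglongrightarrow> D *\<^sub>R h"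
    using h(2) unfolding sums_def by (rule tendsto_scaleR_const)
  then have "(\<lambda>n. d n *\<^sub>R b n) sums (D *\<^sub>R h)"
    using \<open>D > 0\<close> by (simp add: sums_def scaleR_sum_right)
  with h(1) show ?thesis by blast
qed

section \<open>Decreasing a set along a cone\<close>

lemma mem_dilation_iff:
  fixes A H K :: "'b::real_vector set"
  shows "y \<in> A + scaleR r ` H + K \<longleftrightarrow> (\<exists>h\<in>H. y - r *\<^sub>R h \<in> A + K)"
proof
  assume "y \<in> A + scaleR r ` H + K"
  then obtain a h k where "a \<in> A" "h \<in> H" "k \<in> K" "y - r *\<^sub>R h = a + k"
    by (auto elim!: set_plus_elim)
  then show "\<exists>h\<in>H. y - r *\<^sub>R h \<in> A + K"
    by (metis set_plus_intro)
next
  assume "\<exists>h\<in>H. y - r *\<^sub>R h \<in> A + K"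
  then obtain a h k where "a \<in> A" "h \<in> H" "k \<in> K" "y - r *\<^sub>R h = a + k"
    by (auto elim!: set_plus_elim)
  moreover from this have "y = a + r *\<^sub>R h + k"
    by (simp add: algebra_simps)
  ultimately show "y \<in> A + scaleR r ` H + K"
    by blast
qed

lemma plus_cone_add:
  assumes "convex_cone K" "y \<in> A + K" "k \<in> K"
  shows "y + k \<in> A + K"
proof -
  obtain a k' where "a \<in> A" "k' \<in> K" "y = a + k'"
    using assms(2) by (rule set_plus_elim)
  then show ?thesis
    using convex_cone_add[OF assms(1) \<open>k' \<in> K\<close> \<open>k \<in> K\<close>] by (auto simp: add.assoc)
qed

lemma dilation_antimono:
  fixes A H K :: "'b::real_vector set"
  assumes "convex_cone K" "H \<subseteq> K" "r \<le> s"
  shows "A + scaleR s ` H + K \<subseteq> A + scaleR r ` H + K"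
proof
  fix y assume "y \<in> A + scaleR s ` H + K"
  then obtain h where h: "h \<in> H" "y - s *\<^sub>R h \<in> A + K"
    unfolding mem_dilation_iff by blast
  have "(s - r) *\<^sub>R h \<in> K"
    using assms h(1) by (intro convex_cone_scaleR) auto
  from plus_cone_add[OF assms(1) h(2) this] have "y - r *\<^sub>R h \<in> A + K"
    by (simp add: algebra_simps)
  with h(1) show "y \<in> A + scaleR r ` H + K"
    unfolding mem_dilation_iff by blast
qed

lemma convex_merge_scaleR:
  fixes H :: "'b::real_vector set"
  assumes "convex H" "h \<in> H" "h' \<in> H" "0 \<le> r" "0 \<le> s"
  shows "\<exists>w\<in>H. (r + s) *\<^sub>R w = r *\<^sub>R h + s *\<^sub>R h'"
proof (cases "r + s = 0")
  case True
  with assms have "r = 0" "s = 0" by linarith+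
  with \<open>h \<in> H\<close> show ?thesis by auto
next
  case False
  let ?w = "(r / (r + s)) *\<^sub>R h + (s / (r + s)) *\<^sub>R h'"
  have "?w \<in> H"
    using assms False by (intro convexD) (auto simp: add_divide_distrib[symmetric])
  moreover have "(r + s) *\<^sub>R ?w = r *\<^sub>R h + s *\<^sub>R h'"
    using False by (simp add: scaleR_right_distrib)
  ultimately show ?thesis by blast
qed

text \<open>
  Two successive decreases, by \<open>r H\<close> and then by \<open>s H\<close>, amount to one by \<open>(r + s) H\<close>. This is where
  convexity of \<open>H\<close> enters.
\<close>

lemma subset_dilation_trans:
  fixes A B C H K :: "'b::real_vector set"
  assumes K: "convex_cone K" and H: "convex H" and rs: "0 \<le> r" "0 \<le> s"
    and AB: "A \<subseteq> B + scaleR r ` H + K" and BC: "B \<subseteq> C + scaleR s ` H + K"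
  shows "A \<subseteq> C + scaleR (r + s) ` H + K"
proof
  fix y assume "y \<in> A"
  then obtain h where h: "h \<in> H" "y - r *\<^sub>R h \<in> B + K"
    using AB mem_dilation_iff by blast
  then obtain b k where b: "b \<in> B" "k \<in> K" "y - r *\<^sub>R h = b + k"
    by (auto elim: set_plus_elim)
  then obtain h' where h': "h' \<in> H" "b - s *\<^sub>R h' \<in> C + K"
    using BC mem_dilation_iff by blast
  obtain w where w: "w \<in> H" "(r + s) *\<^sub>R w = r *\<^sub>R h + s *\<^sub>R h'"
    using convex_merge_scaleR[OF H h(1) h'(1) rs] by blast
  have "y - (r + s) *\<^sub>R w = b - s *\<^sub>R h' + k"
    using b(3) unfolding w(2) by (simp add: algebra_simps)
  also have "\<dots> \<in> C + K"
    by (rule plus_cone_add[OF K h'(2) b(2)])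
  finally show "y \<in> C + scaleR (r + s) ` H + K"
    using w(1) mem_dilation_iff by blast
qed

lemma subset_dilation_zero:
  fixes A H K :: "'b::real_vector set"
  assumes "convex_cone K" "H \<noteq> {}"
  shows "A \<subseteq> A + scaleR 0 ` H + K"
proof
  fix y assume "y \<in> A"
  then have "y \<in> A + K"
    using convex_cone_contains_0[OF assms(1)] set_plus_intro[of y A 0 K] by simp
  with assms(2) show "y \<in> A + scaleR 0 ` H + K"
    unfolding mem_dilation_iff by auto
qed

lemma dilation_subset_plus_cone:
  fixes A H K :: "'b::real_vector set"
  assumes "convex_cone K" "H \<subseteq> K" "0 \<le> r"
  shows "A + scaleR r ` H + K \<subseteq> A + K"
proof
  fix y assume "y \<in> A + scaleR r ` H + K"
  then obtain h where "h \<in> H" "y - r *\<^sub>R h \<in> A + K"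
    unfolding mem_dilation_iff by blast
  then have "y - r *\<^sub>R h + r *\<^sub>R h \<in> A + K"
    using assms by (intro plus_cone_add convex_cone_scaleR) auto
  then show "y \<in> A + K" by simp
qed

section \<open>The order generated by the sets \<open>S x\<close>\<close>

lemma S_map_refl:
  assumes "convex_cone K" "H \<noteq> {}"
  shows "x \<in> S_map f H K x"
  using subset_dilation_zero[OF assms] by (simp add: S_map_def)

lemma S_map_trans:
  assumes K: "convex_cone K" and H: "H \<subseteq> K" "convex H"
    and x': "x' \<in> S_map f H K x" and x'': "x'' \<in> S_map f H K x'"
  shows "x'' \<in> S_map f H K x"
proof -
  have "f x \<subseteq> f x'' + scaleR (dist x x' + dist x' x'') ` H + K"
    using x' x'' by (intro subset_dilation_trans[OF K H(2)]) (auto simp: S_map_def)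
  also have "\<dots> \<subseteq> f x'' + scaleR (dist x x'') ` H + K"
    by (intro dilation_antimono[OF K H(1)] dist_triangle)
  finally show ?thesis by (simp add: S_map_def)
qed

lemma chain_subset_dilation:
  assumes "convex_cone K" "convex H" "H \<noteq> {}"
    and chain: "\<And>n. u (Suc n) \<in> S_map f H K (u n)"
  shows "f (u 0) \<subseteq> f (u n) + scaleR (\<Sum>i<n. dist (u i) (u (Suc i))) ` H + K"
proof (induction n)
  case 0
  show ?case using subset_dilation_zero[OF assms(1,3)] by simp
next
  case (Suc n)
  have "f (u n) \<subseteq> f (u (Suc n)) + scaleR (dist (u n) (u (Suc n))) ` H + K"
    using chain[of n] by (simp add: S_map_def)
  from subset_dilation_trans[OF assms(1,2) _ _ Suc this] show ?case
    by (simp add: sum_nonneg)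
qed

lemma chain_mem_S_map:
  assumes "convex_cone K" "H \<subseteq> K" "convex H" "H \<noteq> {}"
    and chain: "\<And>n. u (Suc n) \<in> S_map f H K (u n)"
  shows "u n \<in> S_map f H K (u 0)"
proof (induction n)
  case 0
  show ?case by (rule S_map_refl[OF assms(1,4)])
next
  case (Suc n)
  show ?case by (rule S_map_trans[OF assms(1-3) Suc chain])
qed

text \<open>
  Since \<open>H \<subseteq> K\<close>, a decrease by \<open>r H\<close> with \<open>r \<ge> \<epsilon>\<close> is in particular one by \<open>\<epsilon> H\<close>, which the gap at
  \<open>x0\<close> rules out.
\<close>

lemma decrease_less:
  fixes f :: "'a::metric_space \<Rightarrow> 'b::real_vector set"
  assumes "convex_cone K" "H \<subseteq> K"
    and gap: "\<not> f x0 \<subseteq> (\<Union>x\<in>S_map f H K x0. f x) + scaleR \<epsilon> ` H + K"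
    and "x \<in> S_map f H K x0" "f x0 \<subseteq> f x + scaleR r ` H + K"
  shows "r < \<epsilon>"
proof (rule ccontr)
  assume "\<not> r < \<epsilon>"
  then have "f x0 \<subseteq> f x + scaleR \<epsilon> ` H + K"
    using dilation_antimono[OF assms(1,2), of \<epsilon> r "f x"] assms(5) by auto
  also have "\<dots> \<subseteq> (\<Union>x\<in>S_map f H K x0. f x) + scaleR \<epsilon> ` H + K"
    using assms(4) by (intro set_plus_mono2) auto
  finally show False using gap by contradiction
qed

lemma chain_length_less:
  fixes f :: "'a::metric_space \<Rightarrow> 'b::real_vector set"
  assumes "convex_cone K" "H \<subseteq> K" "convex H" "H \<noteq> {}"
    and gap: "\<not> f (u 0) \<subseteq> (\<Union>x\<in>S_map f H K (u 0). f x) + scaleR \<epsilon> ` H + K"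
    and chain: "\<And>n. u (Suc n) \<in> S_map f H K (u n)"
  shows "(\<Sum>i<n. dist (u i) (u (Suc i))) < \<epsilon>"
  using decrease_less[OF assms(1,2) gap chain_mem_S_map[of K H u f, OF assms(1-4) chain]
      chain_subset_dilation[of K H u f, OF assms(1,3,4) chain]] .

text \<open>
  Follow a value \<open>y \<in> f (u 0)\<close> down the chain, to \<open>q n \<in> f (u n)\<close>, with decrease \<open>dist (u n) (u (Suc n))\<close>
  times \<open>h n \<in> H\<close> at step \<open>n\<close>. The choices are consistent in \<open>n\<close>, so the accumulated decreases are
  the partial sums of one series \<open>\<Sum>n. dist (u n) (u (Suc n)) *\<^sub>R h n\<close>; \<open>\<sigma>\<close>-convexity gives its sum in the
  form \<open>D *\<^sub>R w\<close>, where \<open>w \<in> H\<close> and \<open>D \<ge> dist (u 0) z\<close> is the length of the chain.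
\<close>

lemma limit_mem_S_map:
  fixes f :: "'a::metric_space \<Rightarrow> 'b::real_hausdorff_tvs set"
  assumes K: "convex_cone K" and H: "H \<subseteq> K" "sigma_convex H"
    and chain: "\<And>n. u (Suc n) \<in> S_map f H K (u n)"
    and summable: "summable (\<lambda>n. dist (u n) (u (Suc n)))"
    and lim: "u \<longlonglongrightarrow> z"
    and lower: "\<And>n. f (u n) \<subseteq> f z + K"
    and closed: "closed (f z + K)"
  shows "z \<in> S_map f H K (u 0)"
  unfolding S_map_def mem_Collect_eq
proof
  fix y assume y: "y \<in> f (u 0)"
  define d where "d n = dist (u n) (u (Suc n))" for n
  define D where "D = (\<Sum>n. d n)"
  have step: "\<exists>p'. p' \<in> f (u (Suc n)) \<and> (\<exists>h\<in>H. p - d n *\<^sub>R h - p' \<in> K)"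
    if "p \<in> f (u n)" for p n
  proof -
    have "p \<in> f (u (Suc n)) + scaleR (d n) ` H + K"
      using that chain[of n] by (auto simp: S_map_def d_def)
    then obtain h p' k where "h \<in> H" "p' \<in> f (u (Suc n))" "k \<in> K" "p - d n *\<^sub>R h = p' + k"
      unfolding mem_dilation_iff by (auto elim: set_plus_elim)
    then show ?thesis by (metis add_diff_cancel_left')
  qed
  have "\<exists>q. \<forall>n. (q n \<in> f (u n) \<and> (n = 0 \<longrightarrow> q n = y)) \<and> (\<exists>h\<in>H. q n - d n *\<^sub>R h - q (Suc n) \<in> K)"
    using y step by (intro dependent_nat_choice) auto
  then obtain q where q: "\<And>n. q n \<in> f (u n)" "q 0 = y"
    and "\<And>n. \<exists>h\<in>H. q n - d n *\<^sub>R h - q (Suc n) \<in> K"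
    by blast
  then obtain h where h: "\<And>n. h n \<in> H" "\<And>n. q n - d n *\<^sub>R h n - q (Suc n) \<in> K"
    by metis
  have partial: "y - (\<Sum>i<n. d i *\<^sub>R h i) - q n \<in> K" for n
  proof (induction n)
    case 0
    show ?case using convex_cone_contains_0[OF K] q(2) by simp
  next
    case (Suc n)
    from convex_cone_add[OF K Suc h(2)[of n]] show ?case
      by (simp add: algebra_simps)
  qed
  have mem: "y - (\<Sum>i<n. d i *\<^sub>R h i) \<in> f z + K" for n
    using plus_cone_add[OF K _ partial[of n], of "q n" "f z"] q(1)[of n] lower[of n]
    by (auto simp: subset_iff)
  have "d sums D"
    using summable unfolding D_def d_def by (rule summable_sums)
  then obtain w where w: "w \<in> H" "(\<lambda>n. d n *\<^sub>R h n) sums (D *\<^sub>R w)"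
    using sigma_convex_weighted_sums[of H h d D] H(2) h(1) by (auto simp: d_def)
  have "(\<lambda>n. y - (\<Sum>i<n. d i *\<^sub>R h i)) \<longlonglongrightarrow> y - D *\<^sub>R w"
    using w(2) unfolding sums_def by (intro tendsto_diff tendsto_const)
  then have "y - D *\<^sub>R w \<in> f z + K"
    using closed mem by (intro Lim_in_closed_set[where F = sequentially]) auto
  then have "y \<in> f z + scaleR D ` H + K"
    unfolding mem_dilation_iff using w(1) by blast
  moreover have "dist (u 0) z \<le> D"
    using dist_limit_le_suminf_dist[OF summable lim] by (simp add: D_def d_def)
  ultimately show "y \<in> f z + scaleR (dist (u 0) z) ` H + K"
    using dilation_antimono[OF K H(1)] by blast
qed

section \<open>The variational principle\<close>

text \<open>
  Each \<open>S x\<close> with \<open>x \<in> S x0\<close> is bounded, since it lies in \<open>S x0\<close>, whose points have distance less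
  than \<open>\<epsilon>\<close> from \<open>x0\<close>; this makes the greedy choice of the next point possible.
\<close>

lemma exists_greedy_chain:
  fixes f :: "'a::metric_space \<Rightarrow> 'b::real_vector set"
  assumes K: "convex_cone K" and H: "H \<subseteq> K" "convex H" "H \<noteq> {}"
    and gap: "\<not> f x0 \<subseteq> (\<Union>x\<in>S_map f H K x0. f x) + scaleR \<epsilon> ` H + K"
  shows "\<exists>u. u 0 = x0 \<and> (\<forall>n. u (Suc n) \<in> S_map f H K (u n)) \<and>
    (\<forall>n. \<forall>z\<in>S_map f H K (u n). dist (u n) z \<le> 2 * dist (u n) (u (Suc n)))"
proof -
  let ?S = "S_map f H K"
  have less: "dist x0 x < \<epsilon>" if "x \<in> ?S x0" for x
    using decrease_less[OF K H(1) gap that] that by (simp add: S_map_def)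
  have step: "\<exists>x'\<in>?S x. \<forall>z\<in>?S x. dist x z \<le> 2 * dist x x'" if x: "x \<in> ?S x0" for x
  proof (rule near_farthest_point)
    show "x \<in> ?S x" by (rule S_map_refl[OF K H(3)])
    fix z assume "z \<in> ?S x"
    then have "z \<in> ?S x0" by (rule S_map_trans[OF K H(1,2) x])
    then show "dist x z \<le> \<epsilon> + \<epsilon>"
      using less[OF x] less[of z] dist_triangle3[of x z x0] by linarith
  qed
  have "\<exists>u. \<forall>n. (u n \<in> ?S x0 \<and> (n = 0 \<longrightarrow> u n = x0)) \<and>
    (u (Suc n) \<in> ?S (u n) \<and> (\<forall>z\<in>?S (u n). dist (u n) z \<le> 2 * dist (u n) (u (Suc n))))"
  proof (rule dependent_nat_choice)
    show "\<exists>x. x \<in> ?S x0 \<and> (0 = (0::nat) \<longrightarrow> x = x0)"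
      using S_map_refl[OF K H(3)] by blast
    fix x and n :: nat
    assume "x \<in> ?S x0 \<and> (n = 0 \<longrightarrow> x = x0)"
    then have x: "x \<in> ?S x0" ..
    from step[OF x] obtain x' where x': "x' \<in> ?S x" "\<forall>z\<in>?S x. dist x z \<le> 2 * dist x x'" ..
    moreover have "x' \<in> ?S x0" by (rule S_map_trans[OF K H(1,2) x x'(1)])
    ultimately show "\<exists>x'. (x' \<in> ?S x0 \<and> (Suc n = 0 \<longrightarrow> x' = x0)) \<and>
        (x' \<in> ?S x \<and> (\<forall>z\<in>?S x. dist x z \<le> 2 * dist x x'))"
      by blast
  qed
  then show ?thesis by blast
qed

theorem theorem7p1:
  fixes x0 :: "'a::metric_space"
    and K H :: "'b::real_hausdorff_tvs set"
    and f :: "'a \<Rightarrow> 'b set"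
  assumes "convex_cone K" and "K \<noteq> {0}" and "K \<noteq> UNIV"
    and "H \<subseteq> K" and "H \<noteq> {}" and "sigma_convex H" and "0 \<notin> vcl (K + H)"
    and "dynamically_complete (S_map f H K) x0"
    and "\<exists>\<epsilon>>0. \<not> f x0 \<subseteq> (\<Union>x\<in>S_map f H K x0. f x) + scaleR \<epsilon> ` H + K"
    and "K_slm K f" and "\<And>x. closed (f x + K)"
  shows "\<exists>xbar.
    f x0 \<subseteq> f xbar + scaleR (dist x0 xbar) ` H + K \<and>
    (\<forall>x. x \<noteq> xbar \<longrightarrow> \<not> f xbar \<subseteq> f x + scaleR (dist xbar x) ` H + K)"
proof -
  let ?S = "S_map f H K"
  note K = \<open>convex_cone K\<close>
  have H: "H \<subseteq> K" "convex H" "H \<noteq> {}"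
    using assms sigma_convex_imp_convex by auto
  obtain \<epsilon> where gap: "\<not> f x0 \<subseteq> (\<Union>x\<in>?S x0. f x) + scaleR \<epsilon> ` H + K"
    using assms(9) by blast
  obtain u where u0: "u 0 = x0" and chain: "\<And>n. u (Suc n) \<in> ?S (u n)"
    and greedy: "\<And>n z. z \<in> ?S (u n) \<Longrightarrow> dist (u n) z \<le> 2 * dist (u n) (u (Suc n))"
    using exists_greedy_chain[OF K H gap] by blast
  have "(\<Sum>i<n. dist (u i) (u (Suc i))) < \<epsilon>" for n
    using chain_length_less[of K H f u, OF K H _ chain] gap u0 by simp
  then have summable: "summable (\<lambda>n. dist (u n) (u (Suc n)))"
    by (intro summableI_nonneg_bounded[where x = \<epsilon>]) (auto intro: less_imp_le)
  have "u n \<in> ?S x0" for n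
    using chain_mem_S_map[of K H u f, OF K H chain] u0 by simp
  then obtain z where lim: "u \<longlonglongrightarrow> z"
    using assms(8) Cauchy_if_summable_dist[OF summable] chain
    unfolding dynamically_complete_def by blast
  have "f (u n) \<subseteq> f (u (Suc n)) + K" for n
    using chain[of n] dilation_subset_plus_cone[OF K H(1) zero_le_dist]
    unfolding S_map_def mem_Collect_eq by (rule subset_trans)
  then have lower: "f (u n) \<subseteq> f z + K" for n
    using \<open>K_slm K f\<close> lim unfolding K_slm_def by blast
  \<comment> \<open>The tail of a chain is a chain with the same limit.\<close>
  have z: "z \<in> ?S (u n)" for n
  proof -
    have "z \<in> ?S (u (0 + n))"
    proof (rule limit_mem_S_map[where u = "\<lambda>i. u (i + n)", OF K H(1) \<open>sigma_convex H\<close>])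
      show "u (Suc i + n) \<in> ?S (u (i + n))" for i
        using chain[of "i + n"] by simp
      show "summable (\<lambda>i. dist (u (i + n)) (u (Suc i + n)))"
        using summable_ignore_initial_segment[OF summable, of n] by simp
      show "(\<lambda>i. u (i + n)) \<longlonglongrightarrow> z"
        using lim by (rule LIMSEQ_ignore_initial_segment)
    qed (rule lower assms(11))+
    then show ?thesis by simp
  qed
  have "x = z" if x: "x \<in> ?S z" for x
  proof -
    have "\<forall>\<^sub>F n in sequentially. dist (u n) x \<le> dist (2 * dist (u n) (u (Suc n))) 0"
      using greedy[OF S_map_trans[OF K H(1,2) z x]] by (simp add: dist_real_def)
    moreover have "(\<lambda>n. 2 * dist (u n) (u (Suc n))) \<longlonglongrightarrow> 0"
      using tendsto_mult_right_zero[OF summable_LIMSEQ_zero[OF summable]] .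
    ultimately have "u \<longlonglongrightarrow> x"
      using metric_tendsto_imp_tendsto by blast
    then show "x = z"
      using LIMSEQ_unique[OF _ lim] by simp
  qed
  moreover have "z \<in> ?S x0"
    using z[of 0] u0 by simp
  ultimately show ?thesis
    unfolding S_map_def by blast
qed

end
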